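(* Let $G$ be a digraph that has a Maltsev polymorphism. Then $G$ has a majority polymorphism.
   Context: A digraph $G$ is a finite directed graph with loops allowed, with vertex set $V(G)$ and edge relation $E(G)\subseteq V(G)\times V(G)$; the null digraph ($V(G)=\emptyset$) is allowed. A mapping $f:V(G)^n\to V(G)$ is a polymorphism of $G$ if whenever $(u_1,v_1),\dots,(u_n,v_n)\in E(G)$, also $(f(u_1,\dots,u_n),f(v_1,\dots,v_n))\in E(G)$. A Maltsev polymorphism of $G$ is a ternary polymorphism $m$ such that $m(x,y,y)=x$ and $m(x,x,y)=y$ for all $x,y\in V(G)$. A majority polymorphism of $G$ is a ternary polymorphism $M$ such that $M(x,y,y)=M(y,x,y)=M(y,y,x)=y$ for all $x,y\in V(G)$. *)

theory Defs
  imports "Graph_Theory.Pair_Digraph"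
begin

text \<open>
  Digraphs are the \<^locale>\<open>pair_fin_digraph\<close>s of the library: \<^const>\<open>pverts\<close> is a finite, possibly
  empty, set of vertices and \<^const>\<open>parcs\<close> an edge relation on it. Loops are allowed, whereas the
  library's \<open>pair_digraph\<close> excludes them.

  An \<open>n\<close>-ary operation is a function on lists, of which only the values on lists of length \<open>n\<close>
  over the vertex set matter.
\<close>

definition polymorphism :: "'a pair_pre_digraph \<Rightarrow> nat \<Rightarrow> ('a list \<Rightarrow> 'a) \<Rightarrow> bool" where
  "polymorphism G n f \<longleftrightarrow>
     (\<forall>us. length us = n \<and> set us \<subseteq> pverts G \<longrightarrow> f us \<in> pverts G) \<and>
     (\<forall>us vs. length us = n \<and> length vs = n \<and> (\<forall>i<n. (us ! i, vs ! i) \<in> parcs G)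
        \<longrightarrow> (f us, f vs) \<in> parcs G)"

definition maltsev_polymorphism :: "'a pair_pre_digraph \<Rightarrow> ('a list \<Rightarrow> 'a) \<Rightarrow> bool" where
  "maltsev_polymorphism G m \<longleftrightarrow>
     polymorphism G 3 m \<and>
     (\<forall>x\<in>pverts G. \<forall>y\<in>pverts G. m [x, y, y] = x \<and> m [x, x, y] = y)"

definition majority_polymorphism :: "'a pair_pre_digraph \<Rightarrow> ('a list \<Rightarrow> 'a) \<Rightarrow> bool" where
  "majority_polymorphism G M \<longleftrightarrow>
     polymorphism G 3 M \<and>
     (\<forall>x\<in>pverts G. \<forall>y\<in>pverts G. M [x, y, y] = y \<and> M [y, x, y] = y \<and> M [y, y, x] = y)"

end

theory Submission
  imports Defs
begin

text \<open>
  A Maltsev polymorphism makes the edge relation \<open>E\<close> rectangular: if two vertices have a common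
  out-neighbour, then they have the same out-neighbours. Hence \<open>E\<close> is a disjoint union of complete
  bipartite pieces \<open>A \<times> B\<close> (bicliques), where the source sides \<open>A\<close> are the classes of vertices with
  the same nonempty out-neighbourhood and the target sides \<open>B\<close> are those out-neighbourhoods.

  The bicliques are the vertices of a new digraph, the \<^emph>\<open>biclique digraph\<close>: there is an edge from one
  biclique to another if some vertex of \<open>G\<close> lies in the target side of the first and in the source
  side of the second. The Maltsev polymorphism passes to it. A majority polymorphism \<open>M'\<close> of the
  biclique digraph lifts to \<open>G\<close>. Indeed, if three vertices have out-edges, in the bicliques
  \<open>C\<^sub>1, C\<^sub>2, C\<^sub>3\<close>, their majority value is required to lie in the source side of
  \<open>M' C\<^sub>1 C\<^sub>2 C\<^sub>3\<close>; if they have in-edges, in the bicliques \<open>B\<^sub>1, B\<^sub>2, B\<^sub>3\<close>, it is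
  required to lie in the target side of \<open>M' B\<^sub>1 B\<^sub>2 B\<^sub>3\<close>. Any choice that meets these
  requirements preserves edges. If both apply, then each \<open>B\<^sub>i\<close> has an edge to \<open>C\<^sub>i\<close>, so
  \<open>M' B\<^sub>1 B\<^sub>2 B\<^sub>3\<close> has an edge to \<open>M' C\<^sub>1 C\<^sub>2 C\<^sub>3\<close>, and this edge says that the two
  requirements can be met together. Where two of the vertices agree, their common value already
  satisfies them, because \<open>M'\<close> is itself a majority operation (\<open>majority_lifts\<close>).

  There are at most as many bicliques as vertices. When there are fewer, induction on the number of
  vertices applies. When there are equally many, all bicliques are single edges, so \<open>E\<close> is a
  permutation, and any operation that chooses one of its arguments by testing which of them are equal preserves \<open>E\<close>
  (\<open>majority_of_permutation\<close>).
\<close>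

section \<open>Ternary operations on a digraph\<close>

definition ternary_polymorphism :: "'a set \<Rightarrow> 'a rel \<Rightarrow> ('a \<Rightarrow> 'a \<Rightarrow> 'a \<Rightarrow> 'a) \<Rightarrow> bool" where
  "ternary_polymorphism V E f \<longleftrightarrow>
     (\<forall>x\<in>V. \<forall>y\<in>V. \<forall>z\<in>V. f x y z \<in> V) \<and>
     (\<forall>a b c x y z. (a, x) \<in> E \<longrightarrow> (b, y) \<in> E \<longrightarrow> (c, z) \<in> E \<longrightarrow> (f a b c, f x y z) \<in> E)"

definition ternary_majority :: "'a set \<Rightarrow> 'a rel \<Rightarrow> ('a \<Rightarrow> 'a \<Rightarrow> 'a \<Rightarrow> 'a) \<Rightarrow> bool" where
  "ternary_majority V E M \<longleftrightarrow>
     ternary_polymorphism V E M \<and>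
     (\<forall>x\<in>V. \<forall>y\<in>V. M x y y = y \<and> M y x y = y \<and> M y y x = y)"

lemma ternary_polymorphismI:
  assumes "\<And>x y z. x \<in> V \<Longrightarrow> y \<in> V \<Longrightarrow> z \<in> V \<Longrightarrow> f x y z \<in> V"
    and "\<And>a b c x y z. (a, x) \<in> E \<Longrightarrow> (b, y) \<in> E \<Longrightarrow> (c, z) \<in> E \<Longrightarrow> (f a b c, f x y z) \<in> E"
  shows "ternary_polymorphism V E f"
  using assms unfolding ternary_polymorphism_def by blast

lemma polymorphism_3_iff_ternary_polymorphism:
  "polymorphism G 3 f \<longleftrightarrow>
     ternary_polymorphism (pverts G) (parcs G) (\<lambda>x y z. f [x, y, z])" (is "?L \<longleftrightarrow> ?R")
proof
  assume L: ?L
  show ?R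
  proof (rule ternary_polymorphismI)
    fix x y z
    assume "x \<in> pverts G" "y \<in> pverts G" "z \<in> pverts G"
    then show "f [x, y, z] \<in> pverts G"
      using L unfolding polymorphism_def by simp
  next
    fix a b c x y z
    assume "(a, x) \<in> parcs G" "(b, y) \<in> parcs G" "(c, z) \<in> parcs G"
    then have "\<forall>i<3. ([a, b, c] ! i, [x, y, z] ! i) \<in> parcs G"
      by (simp add: numeral_3_eq_3 All_less_Suc2)
    then show "(f [a, b, c], f [x, y, z]) \<in> parcs G"
      using L unfolding polymorphism_def by simp
  qed
next
  assume R: ?R
  have list3: "\<exists>x y z. us = [x, y, z]" if "length us = 3" for us :: "'a list"
    using that by (auto simp: numeral_3_eq_3 length_Suc_conv)
  have "f us \<in> pverts G" if "length us = 3" "set us \<subseteq> pverts G" for us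
    using R list3[OF that(1)] that(2) unfolding ternary_polymorphism_def by auto
  moreover have "(f us, f vs) \<in> parcs G"
    if "length us = 3" "length vs = 3" "\<forall>i<3. (us ! i, vs ! i) \<in> parcs G" for us vs
  proof -
    obtain a b c x y z where eqs: "us = [a, b, c]" "vs = [x, y, z]"
      using list3 \<open>length us = 3\<close> \<open>length vs = 3\<close> by metis
    then have "(a, x) \<in> parcs G" "(b, y) \<in> parcs G" "(c, z) \<in> parcs G"
      using that(3) by (simp_all add: numeral_3_eq_3 All_less_Suc2)
    then show ?thesis
      using R eqs unfolding ternary_polymorphism_def by blast
  qed
  ultimately show ?L
    unfolding polymorphism_def by blast
qed

locale maltsev_digraph =
  fixes V :: "'a set" and E :: "'a rel" and m :: "'a \<Rightarrow> 'a \<Rightarrow> 'a \<Rightarrow> 'a"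
  assumes finite_V: "finite V"
    and E_subset: "E \<subseteq> V \<times> V"
    and m_polymorphism: "ternary_polymorphism V E m"
    and m_right: "x \<in> V \<Longrightarrow> y \<in> V \<Longrightarrow> m x y y = x"
    and m_left: "x \<in> V \<Longrightarrow> y \<in> V \<Longrightarrow> m x x y = y"
begin

lemma m_edge: "(a, x) \<in> E \<Longrightarrow> (b, y) \<in> E \<Longrightarrow> (c, z) \<in> E \<Longrightarrow> (m a b c, m x y z) \<in> E"
  using m_polymorphism unfolding ternary_polymorphism_def by blast

text \<open>
  Applying \<open>m\<close> to the edges \<open>a \<rightarrow> b\<close>, \<open>c \<rightarrow> b\<close>, \<open>c \<rightarrow> d\<close> yields the edge \<open>a \<rightarrow> d\<close>.
\<close>

lemma rectangular:
  assumes "(a, b) \<in> E" "(c, b) \<in> E" "(c, d) \<in> E"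
  shows "(a, d) \<in> E"
proof -
  have "m a c c = a" "m b b d = d"
    using assms E_subset by (auto intro: m_right m_left)
  then show ?thesis
    using m_edge[OF assms] by simp
qed

lemma same_out_neighbours:
  assumes "(a, b) \<in> E" "(c, b) \<in> E"
  shows "E `` {a} = E `` {c}"
  using rectangular[OF assms] rectangular[OF assms(2,1)] by auto

section \<open>The biclique digraph\<close>

text \<open>
  A biclique is represented by one vertex of its source side, so that the biclique digraph has its
  vertices in \<open>V\<close> and the induction can stay within one type.
\<close>

definition rep :: "'a \<Rightarrow> 'a" where
  "rep x = (SOME w. w \<in> V \<and> E `` {w} = E `` {x})"

definition bicliques :: "'a set" where
  "bicliques = rep ` Domain E"

definition biclique_edges :: "'a rel" where
  "biclique_edges =
     {(x, y). x \<in> bicliques \<and> y \<in> bicliques \<and> (\<exists>z. (x, z) \<in> E \<and> E `` {z} = E `` {y})}"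

lemma rep_in_V: "x \<in> V \<Longrightarrow> rep x \<in> V"
  and out_neighbours_rep: "x \<in> V \<Longrightarrow> E `` {rep x} = E `` {x}"
proof -
  assume "x \<in> V"
  then have "rep x \<in> V \<and> E `` {rep x} = E `` {x}"
    unfolding rep_def using someI[of "\<lambda>w. w \<in> V \<and> E `` {w} = E `` {x}" x] by simp
  then show "rep x \<in> V" "E `` {rep x} = E `` {x}" by auto
qed

lemma rep_cong: "E `` {x} = E `` {y} \<Longrightarrow> rep x = rep y"
  unfolding rep_def by simp

lemma rep_edge_iff: "x \<in> V \<Longrightarrow> (rep x, y) \<in> E \<longleftrightarrow> (x, y) \<in> E"
  using out_neighbours_rep[of x] by auto

lemma rep_in_bicliques: "(x, y) \<in> E \<Longrightarrow> rep x \<in> bicliques"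
  unfolding bicliques_def by auto

lemma bicliques_subset: "bicliques \<subseteq> V"
  unfolding bicliques_def using E_subset by (auto intro!: rep_in_V)

lemma bicliques_subset_Domain: "bicliques \<subseteq> Domain E"
proof
  fix w
  assume "w \<in> bicliques"
  then obtain x y where "(x, y) \<in> E" "w = rep x"
    unfolding bicliques_def by auto
  moreover have "x \<in> V"
    using \<open>(x, y) \<in> E\<close> E_subset by auto
  ultimately show "w \<in> Domain E"
    using rep_edge_iff[of x y] by auto
qed

lemma rep_of_biclique: "x \<in> bicliques \<Longrightarrow> rep x = x"
  unfolding bicliques_def using E_subset by (auto intro!: rep_cong[OF out_neighbours_rep])

lemma biclique_edge_through:
  assumes "(a, x) \<in> E" "x \<in> Domain E"
  shows "(rep a, rep x) \<in> biclique_edges"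
proof -
  have "a \<in> V" "x \<in> V"
    using assms E_subset by auto
  moreover have "rep a \<in> bicliques" "rep x \<in> bicliques"
    using assms by (auto intro: rep_in_bicliques)
  ultimately show ?thesis
    using assms(1) rep_edge_iff[of a x] out_neighbours_rep[of x]
    unfolding biclique_edges_def by auto
qed

text \<open>
  Each edge between bicliques passes through a vertex \<open>z\<close> of the original digraph. If
  \<open>z\<^sub>1, z\<^sub>2, z\<^sub>3\<close> witness three edges, then \<open>m z\<^sub>1 z\<^sub>2 z\<^sub>3\<close> witnesses the edge between the
  values.
\<close>

lemma maltsev_biclique_digraph:
  "maltsev_digraph bicliques biclique_edges (\<lambda>x y z. rep (m x y z))"
proof (rule maltsev_digraph.intro)
  show "finite bicliques"
    using bicliques_subset finite_V by (rule finite_subset)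
  show "biclique_edges \<subseteq> bicliques \<times> bicliques"
    unfolding biclique_edges_def by blast
  show "rep (m x y y) = x" if "x \<in> bicliques" "y \<in> bicliques" for x y
    using that bicliques_subset by (simp add: subset_iff m_right rep_of_biclique)
  show "rep (m x x y) = y" if "x \<in> bicliques" "y \<in> bicliques" for x y
    using that bicliques_subset by (simp add: subset_iff m_left rep_of_biclique)
  have closed: "rep (m x y z) \<in> bicliques"
    if "x \<in> bicliques" "y \<in> bicliques" "z \<in> bicliques" for x y z
  proof -
    have "x \<in> Domain E" "y \<in> Domain E" "z \<in> Domain E"
      using that bicliques_subset_Domain by auto
    then obtain x' y' z' where "(x, x') \<in> E" "(y, y') \<in> E" "(z, z') \<in> E"
      by (elim DomainE)
    then show ?thesis
      by (rule rep_in_bicliques[OF m_edge])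
  qed
  show "ternary_polymorphism bicliques biclique_edges (\<lambda>x y z. rep (m x y z))"
  proof (rule ternary_polymorphismI)
    fix a b c x y z
    assume edges: "(a, x) \<in> biclique_edges" "(b, y) \<in> biclique_edges" "(c, z) \<in> biclique_edges"
    then obtain u v w where
      into: "(a, u) \<in> E" "(b, v) \<in> E" "(c, w) \<in> E" and
      same: "E `` {u} = E `` {x}" "E `` {v} = E `` {y}" "E `` {w} = E `` {z}"
      unfolding biclique_edges_def by auto
    have "x \<in> Domain E" "y \<in> Domain E" "z \<in> Domain E"
      using edges bicliques_subset_Domain unfolding biclique_edges_def by auto
    then obtain x' y' z' where
      out: "(x, x') \<in> E" "(y, y') \<in> E" "(z, z') \<in> E"
      by (elim DomainE)
    then have "x' \<in> E `` {u}" "y' \<in> E `` {v}" "z' \<in> E `` {w}"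
      unfolding same by simp_all
    \<comment> \<open>Both \<open>m u v w\<close> and \<open>m x y z\<close> point to \<open>m x' y' z'\<close>, so they belong to the same source side.\<close>
    then have uvw: "(m u v w, m x' y' z') \<in> E"
      by (intro m_edge) simp_all
    have "rep (m u v w) = rep (m x y z)"
      using same_out_neighbours[OF uvw m_edge[OF out]] by (rule rep_cong)
    moreover have "(rep (m a b c), rep (m u v w)) \<in> biclique_edges"
      using m_edge[OF into] uvw by (intro biclique_edge_through) auto
    ultimately show "(rep (m a b c), rep (m x y z)) \<in> biclique_edges"
      by simp
  qed (rule closed)
qed

section \<open>Lifting a majority polymorphism\<close>

text \<open>
  The requirements on the value \<open>w\<close> of the lifted operation at \<open>x, y, z\<close>: it lies in the source side
  prescribed by \<open>M'\<close> if \<open>x, y, z\<close> have out-edges, in the target side prescribed by \<open>M'\<close> if they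
  have in-edges, and it obeys the majority rule.
\<close>

definition admissible :: "('a \<Rightarrow> 'a \<Rightarrow> 'a \<Rightarrow> 'a) \<Rightarrow> 'a \<Rightarrow> 'a \<Rightarrow> 'a \<Rightarrow> 'a \<Rightarrow> bool" where
  "admissible M' x y z w \<longleftrightarrow>
     w \<in> V \<and>
     (x \<in> Domain E \<and> y \<in> Domain E \<and> z \<in> Domain E
        \<longrightarrow> E `` {w} = E `` {M' (rep x) (rep y) (rep z)}) \<and>
     (\<forall>a b c. (a, x) \<in> E \<longrightarrow> (b, y) \<in> E \<longrightarrow> (c, z) \<in> E
        \<longrightarrow> (M' (rep a) (rep b) (rep c), w) \<in> E) \<and>
     (x = y \<or> x = z \<longrightarrow> w = x) \<and> (y = z \<longrightarrow> w = y)"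

lemma rep_eq_of_common_out_neighbour: "(a, x) \<in> E \<Longrightarrow> (b, x) \<in> E \<Longrightarrow> rep a = rep b"
  by (rule rep_cong[OF same_out_neighbours])

text \<open>
  If two of the arguments agree, then so do the bicliques around them, and the majority rule for \<open>M'\<close>
  makes the common value admissible. If all three differ, the requirements on the source and the
  target side can conflict only when both are in force, and then the vertex witnessing an edge of the
  biclique digraph between the two values of \<open>M'\<close> satisfies both.
\<close>

lemma admissible_exists:
  assumes M': "ternary_majority bicliques biclique_edges M'"
    and V: "x \<in> V" "y \<in> V" "z \<in> V"
  shows "\<exists>w. admissible M' x y z w"
proof -
  have M'_closed: "M' p q r \<in> bicliques" if "p \<in> bicliques" "q \<in> bicliques" "r \<in> bicliques" for p q r
    using M' that unfolding ternary_majority_def ternary_polymorphism_def by blast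
  have M'_edge: "(M' p q r, M' s t u) \<in> biclique_edges"
    if "(p, s) \<in> biclique_edges" "(q, t) \<in> biclique_edges" "(r, u) \<in> biclique_edges" for p q r s t u
    using M' that unfolding ternary_majority_def ternary_polymorphism_def by blast
  have M'_maj: "M' p q q = q" "M' q p q = q" "M' q q p = q"
    if "p \<in> bicliques" "q \<in> bicliques" for p q
    using M' that unfolding ternary_majority_def by blast+
  consider (yz) "y = z" | (xz) "x = z" | (xy) "x = y" | (distinct) "y \<noteq> z" "x \<noteq> z" "x \<noteq> y"
    by blast
  then show ?thesis
  proof cases
    case yz
    have "(M' (rep a) (rep b) (rep c), y) \<in> E" if "(a, x) \<in> E" "(b, y) \<in> E" "(c, y) \<in> E" for a b c
    proof -
      have "rep c = rep b"
        using rep_eq_of_common_out_neighbour that by blast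
      then have "M' (rep a) (rep b) (rep c) = rep b"
        using M'_maj(1)[OF rep_in_bicliques rep_in_bicliques] that by metis
      then show ?thesis
        using that rep_edge_iff E_subset by auto
    qed
    moreover have "E `` {y} = E `` {M' (rep x) (rep y) (rep y)}" if "x \<in> Domain E" "y \<in> Domain E"
      using M'_maj(1)[of "rep x" "rep y"] that out_neighbours_rep V unfolding bicliques_def by auto
    ultimately have "admissible M' x y z y"
      unfolding admissible_def using yz V by simp
    then show ?thesis ..
  next
    case xz
    have "(M' (rep a) (rep b) (rep c), x) \<in> E" if "(a, x) \<in> E" "(b, y) \<in> E" "(c, x) \<in> E" for a b c
    proof -
      have "rep c = rep a"
        using rep_eq_of_common_out_neighbour that by blast
      then have "M' (rep a) (rep b) (rep c) = rep a"
        using M'_maj(2)[OF rep_in_bicliques rep_in_bicliques] that by metis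
      then show ?thesis
        using that rep_edge_iff E_subset by auto
    qed
    moreover have "E `` {x} = E `` {M' (rep x) (rep y) (rep x)}" if "x \<in> Domain E" "y \<in> Domain E"
      using M'_maj(2)[of "rep y" "rep x"] that out_neighbours_rep V unfolding bicliques_def by auto
    ultimately have "admissible M' x y z x"
      unfolding admissible_def using xz V by simp
    then show ?thesis ..
  next
    case xy
    have "(M' (rep a) (rep b) (rep c), x) \<in> E" if "(a, x) \<in> E" "(b, x) \<in> E" "(c, z) \<in> E" for a b c
    proof -
      have "rep b = rep a"
        using rep_eq_of_common_out_neighbour that by blast
      then have "M' (rep a) (rep b) (rep c) = rep a"
        using M'_maj(3)[OF rep_in_bicliques rep_in_bicliques] that by metis
      then show ?thesis
        using that rep_edge_iff E_subset by auto
    qed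
    moreover have "E `` {x} = E `` {M' (rep x) (rep x) (rep z)}" if "x \<in> Domain E" "z \<in> Domain E"
      using M'_maj(3)[of "rep z" "rep x"] that out_neighbours_rep V unfolding bicliques_def by auto
    ultimately have "admissible M' x y z x"
      unfolding admissible_def using xy V by simp
    then show ?thesis ..
  next
    case distinct
    let ?C = "M' (rep x) (rep y) (rep z)"
    show ?thesis
    proof (cases "x \<in> Range E \<and> y \<in> Range E \<and> z \<in> Range E")
      case True
      then obtain a b c where abc: "(a, x) \<in> E" "(b, y) \<in> E" "(c, z) \<in> E"
        by blast
      let ?B = "M' (rep a) (rep b) (rep c)"
      have B_unique: "M' (rep a') (rep b') (rep c') = ?B"
        if "(a', x) \<in> E" "(b', y) \<in> E" "(c', z) \<in> E" for a' b' c'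
        using that abc rep_eq_of_common_out_neighbour by metis
      have "\<exists>w. (?B, w) \<in> E \<and>
              (x \<in> Domain E \<and> y \<in> Domain E \<and> z \<in> Domain E \<longrightarrow> E `` {w} = E `` {?C})"
      proof (cases "x \<in> Domain E \<and> y \<in> Domain E \<and> z \<in> Domain E")
        case True
        then have "(?B, ?C) \<in> biclique_edges"
          using abc by (intro M'_edge biclique_edge_through) auto
        then show ?thesis
          unfolding biclique_edges_def by blast
      next
        case False
        have "?B \<in> bicliques"
          using abc by (intro M'_closed) (auto intro: rep_in_bicliques)
        then show ?thesis
          using False bicliques_subset_Domain by blast
      qed
      then obtain w where "(?B, w) \<in> E"
        and "x \<in> Domain E \<and> y \<in> Domain E \<and> z \<in> Domain E \<longrightarrow> E `` {w} = E `` {?C}"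
        by blast
      moreover have "(M' (rep a') (rep b') (rep c'), w) \<in> E"
        if "(a', x) \<in> E" "(b', y) \<in> E" "(c', z) \<in> E" for a' b' c'
        unfolding B_unique[OF that] by (rule \<open>(?B, w) \<in> E\<close>)
      ultimately have "admissible M' x y z w"
        unfolding admissible_def using distinct E_subset by blast
      then show ?thesis ..
    next
      case no_target: False
      show ?thesis
      proof (cases "x \<in> Domain E \<and> y \<in> Domain E \<and> z \<in> Domain E")
        case True
        then have "?C \<in> bicliques"
          by (intro M'_closed) (auto simp: bicliques_def)
        then have "admissible M' x y z ?C"
          unfolding admissible_def using no_target distinct bicliques_subset by auto
        then show ?thesis ..
      next
        case False
        then have "admissible M' x y z x"
          unfolding admissible_def using no_target distinct V by auto
        then show ?thesis ..
      qed
    qed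
  qed
qed

text \<open>
  If \<open>a \<rightarrow> x\<close>, \<open>b \<rightarrow> y\<close>, \<open>c \<rightarrow> z\<close>, then the source side prescribed at \<open>a, b, c\<close> and the target side
  prescribed at \<open>x, y, z\<close> belong to the same biclique, so any two admissible values are adjacent.
\<close>

lemma majority_lifts:
  assumes M': "ternary_majority bicliques biclique_edges M'"
  shows "\<exists>M. ternary_majority V E M"
proof -
  define M where "M x y z = (SOME w. admissible M' x y z w)" for x y z
  have adm: "admissible M' x y z (M x y z)" if "x \<in> V" "y \<in> V" "z \<in> V" for x y z
    unfolding M_def by (rule someI_ex[OF admissible_exists[OF M' that]])
  have maj: "(x = y \<or> x = z \<longrightarrow> M x y z = x) \<and> (y = z \<longrightarrow> M x y z = y)"
    if "x \<in> V" "y \<in> V" "z \<in> V" for x y z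
    using adm[OF that] unfolding admissible_def by (elim conjE) (intro conjI)
  have "ternary_polymorphism V E M"
  proof (rule ternary_polymorphismI)
    show "M x y z \<in> V" if "x \<in> V" "y \<in> V" "z \<in> V" for x y z
      using adm[OF that] unfolding admissible_def by blast
    fix a b c x y z
    assume edges: "(a, x) \<in> E" "(b, y) \<in> E" "(c, z) \<in> E"
    then have V: "a \<in> V" "b \<in> V" "c \<in> V" "x \<in> V" "y \<in> V" "z \<in> V"
      using E_subset by auto
    have "E `` {M a b c} = E `` {M' (rep a) (rep b) (rep c)}"
      using adm[OF V(1-3)] edges unfolding admissible_def by blast
    moreover have "(M' (rep a) (rep b) (rep c), M x y z) \<in> E"
      using adm[OF V(4-6)] edges unfolding admissible_def by blast
    ultimately show "(M a b c, M x y z) \<in> E"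
      by blast
  qed
  moreover have "M x y y = y \<and> M y x y = y \<and> M y y x = y" if "x \<in> V" "y \<in> V" for x y
    using maj[of x y y] maj[of y x y] maj[of y y x] that by simp
  ultimately have "ternary_majority V E M"
    unfolding ternary_majority_def by simp
  then show ?thesis
    by (rule exI[of "ternary_majority V E"])
qed

section \<open>Permutations and the induction\<close>

text \<open>
  If every vertex represents a biclique of its own, then the out-neighbourhoods are nonempty,
  pairwise disjoint and as numerous as the vertices, so each of them is a singleton. Equality tests
  on the tails of edges then agree with equality tests on their heads.
\<close>

lemma majority_of_permutation:
  assumes "bicliques = V"
  shows "\<exists>M. ternary_majority V E M"
proof -
  have tail_unique: "a = b" if "(a, x) \<in> E" "(b, x) \<in> E" for a b x
  proof -
    have "a \<in> bicliques" "b \<in> bicliques"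
      unfolding assms using that E_subset by auto
    then show ?thesis
      using rep_eq_of_common_out_neighbour[OF that] rep_of_biclique by metis
  qed
  have "\<forall>x\<in>V. \<exists>y. (x, y) \<in> E"
    using bicliques_subset_Domain unfolding assms by blast
  then have "\<exists>f. \<forall>x\<in>V. (x, f x) \<in> E"
    by (rule bchoice)
  then obtain f where f: "(x, f x) \<in> E" if "x \<in> V" for x
    by blast
  have "inj_on f V"
  proof (rule inj_onI)
    fix x y
    assume "x \<in> V" "y \<in> V" "f x = f y"
    then show "x = y"
      using f[of x] f[of y] tail_unique by simp
  qed
  moreover have "f ` V \<subseteq> V"
    using f E_subset by blast
  ultimately have surj: "f ` V = V"
    using endo_inj_surj[OF finite_V] by blast
  have head: "y = f x" if "(x, y) \<in> E" for x y
  proof -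
    have "y \<in> f ` V"
      unfolding surj using that E_subset by auto
    then obtain x' where "x' \<in> V" "y = f x'"
      by blast
    then show ?thesis
      using tail_unique[OF that, of x'] f[of x'] by simp
  qed
  have eq_iff: "b = c \<longleftrightarrow> y = z" if "(b, y) \<in> E" "(c, z) \<in> E" for b c y z
    using head[OF that(1)] head[OF that(2)] tail_unique that by blast
  define M where "M x y z = (if y = z then y else x)" for x y z :: 'a
  have "ternary_majority V E M"
    unfolding ternary_majority_def ternary_polymorphism_def M_def using eq_iff by simp
  then show ?thesis
    by (rule exI[of "ternary_majority V E"])
qed

end

theorem maltsev_digraph_has_majority:
  assumes "maltsev_digraph V E m"
  shows "\<exists>M. ternary_majority V E M"
  using assms
proof (induction "card V" arbitrary: V E m rule: less_induct)
  case less
  interpret maltsev_digraph V E m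
    by (rule less.prems)
  show ?case
  proof (cases "bicliques = V")
    case True
    then show ?thesis
      by (rule majority_of_permutation)
  next
    case False
    then have "card bicliques < card V"
      using bicliques_subset finite_V by (intro psubset_card_mono) auto
    then have "\<exists>M'. ternary_majority bicliques biclique_edges M'"
      using maltsev_biclique_digraph by (rule less.hyps)
    then obtain M' where "ternary_majority bicliques biclique_edges M'"
      by (rule exE)
    then show ?thesis
      by (rule majority_lifts)
  qed
qed

theorem theorem13:
  fixes G :: "'a pair_pre_digraph"
  assumes "pair_fin_digraph G"
    and "\<exists>m. maltsev_polymorphism G m"
  shows "\<exists>M. majority_polymorphism G M"
proof -
  interpret pair_fin_digraph G
    by (rule assms(1))
  obtain m where m: "maltsev_polymorphism G m"
    using assms(2) by (rule exE)
  have "maltsev_digraph (pverts G) (parcs G) (\<lambda>x y z. m [x, y, z])"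
  proof (rule maltsev_digraph.intro)
    show "finite (pverts G)"
      by (rule pair_finite_verts)
    show "parcs G \<subseteq> pverts G \<times> pverts G"
      using in_arcsD1 in_arcsD2 by (simp add: subset_iff)
  qed (use m in \<open>simp_all add: maltsev_polymorphism_def polymorphism_3_iff_ternary_polymorphism\<close>)
  then have "\<exists>M. ternary_majority (pverts G) (parcs G) M"
    by (rule maltsev_digraph_has_majority)
  then obtain M where M: "ternary_majority (pverts G) (parcs G) M"
    by (rule exE)
  have "majority_polymorphism G (\<lambda>us. M (us ! 0) (us ! 1) (us ! 2))"
    using M unfolding majority_polymorphism_def polymorphism_3_iff_ternary_polymorphism
      ternary_majority_def by simp
  then show ?thesis
    by (rule exI[of "majority_polymorphism G"])
qed

end
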